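(* Let $D_{2m}=\langle r,s\mid r^m=s^2=1,\ srs=r^{-1}\rangle$ be the dihedral group and let $\varphi,\psi:D_{2m}\to S_n$ be homomorphisms that are generator-conjugate with respect to $r,s$ and satisfy $\varphi(r)=\psi(r)=\sigma$. Write $\sigma=\sigma_1\cdots\sigma_l$, where $\sigma_i$ is the product of all the cycles of length $d_i$ in the disjoint cycle decomposition of $\sigma$ and $d_1,\dots,d_l\ge2$ are distinct. Then $\varphi,\psi$ are conjugate if and only if they are element-conjugate on restriction to $S_{\mathbf{Fix}(\sigma)}$ and on restriction to $H_{\sigma_i}$ for each $1\le i\le l$; that is, if and only if the component homomorphisms $\varphi_0,\psi_0:D_{2m}\to S_{\mathbf{Fix}(\sigma)}$ are element-conjugate in $S_{\mathbf{Fix}(\sigma)}$ and, for each $1\le i\le l$, the component homomorphisms $\varphi_i,\psi_i:D_{2m}\to H_{\sigma_i}\subseteq S_{X_{\sigma_i}}$ are element-conjugate as homomorphisms to the symmetric group $S_{X_{\sigma_i}}$.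
   Context: $S_n$ is the symmetric group of $\{1,\dots,n\}$ and $S_X$ that of a set $X$; for $X\subseteq\{1,\dots,n\}$, $S_X$ is regarded as a subgroup of $S_n$. $\mathbf{Fix}(\sigma)$ is the set of fixed points of $\sigma$ and $X_\sigma=\{1,\dots,n\}\setminus\mathbf{Fix}(\sigma)$. Homomorphisms $\varphi,\psi:G\to H$ are generator-conjugate with respect to generators $g_1,\dots,g_r$ of $G$ if for each $i$ there is $h\in H$ (depending on $i$) with $h\varphi(g_i)h^{-1}=\psi(g_i)$. They are element-conjugate if for every $g\in G$ there is $h\in H$ (depending on $g$) with $h\varphi(g)h^{-1}=\psi(g)$. They are conjugate if there is a single $h\in H$ with $h\varphi(g)h^{-1}=\psi(g)$ for all $g\in G$. $H_{\sigma_i}=\{x\in S_{X_{\sigma_i}} : x\sigma_ix^{-1}=\sigma_i^z \text{ for some } z\in\mathbb{Z}\}$. All elements in the images of $\varphi$ and $\psi$ conjugate $\sigma$ to $\sigma$ or $\sigma^{-1}$, hence preserve $\mathbf{Fix}(\sigma)$ and each $X_{\sigma_i}$. The component homomorphisms $\varphi_0,\varphi_1,\dots,\varphi_l$ (resp. $\psi_0,\dots,\psi_l$) are obtained by restricting the permutations $\varphi(g)$ (resp. $\psi(g)$) to $\mathbf{Fix}(\sigma),X_{\sigma_1},\dots,X_{\sigma_l}$; for $i\geq1$ they take values in $H_{\sigma_i}$. These are the restrictions of $\varphi$ (resp. $\psi$) to $S_{\mathbf{Fix}(\sigma)}$ and to $H_{\sigma_i}$. *)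

theory Defs
  imports "HOL-Algebra.Sym_Groups"
begin

section \<open>Groups given by generators and relations\<close>

text \<open>
  A word is a list of letters; the letter \<open>(True, a)\<close> stands for the generator \<open>a\<close> and
  \<open>(False, a)\<close> for its formal inverse. A set of pairs \<open>(u, v)\<close> of words encodes the defining
  relations \<open>u = v\<close>.
\<close>

type_synonym 'a word = "(bool \<times> 'a) list"

inductive word_eq :: "('a word \<times> 'a word) set \<Rightarrow> 'a word \<Rightarrow> 'a word \<Rightarrow> bool"
  for rels where
  relation: "(u, v) \<in> rels \<Longrightarrow> word_eq rels u v"
| cancel: "word_eq rels [(b, a), (\<not> b, a)] []"
| cong: "word_eq rels u v \<Longrightarrow> word_eq rels (x @ u @ y) (x @ v @ y)"
| refl: "word_eq rels u u"
| sym: "word_eq rels u v \<Longrightarrow> word_eq rels v u"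
| trans: "word_eq rels u v \<Longrightarrow> word_eq rels v w \<Longrightarrow> word_eq rels u w"

definition word_class :: "('a word \<times> 'a word) set \<Rightarrow> 'a word \<Rightarrow> 'a word set" where
  "word_class rels u = {v. word_eq rels u v}"

definition presented_group :: "('a word \<times> 'a word) set \<Rightarrow> 'a word set monoid" where
  "presented_group rels =
     \<lparr> carrier = range (word_class rels),
       monoid.mult = (\<lambda>A B. {w. \<exists>u\<in>A. \<exists>v\<in>B. word_eq rels (u @ v) w}),
       monoid.one = word_class rels [] \<rparr>"

lemma word_class_eq_iff: "word_class R u = word_class R v \<longleftrightarrow> word_eq R u v"
  unfolding word_class_def
  by (metis (no_types, lifting) Collect_cong mem_Collect_eq word_eq.refl word_eq.sym word_eq.trans)

lemma word_eq_append:
  assumes "word_eq R u u'" "word_eq R v v'"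
  shows "word_eq R (u @ v) (u' @ v')"
  using word_eq.cong[OF assms(1), of "[]" v] word_eq.cong[OF assms(2), of u' "[]"]
  by (auto intro: word_eq.trans)

lemma presented_group_mult:
  "word_class R u \<otimes>\<^bsub>presented_group R\<^esub> word_class R v = word_class R (u @ v)"
  unfolding presented_group_def word_class_def
  by (auto intro: word_eq.refl word_eq.trans word_eq_append)

lemma presented_group_one: "\<one>\<^bsub>presented_group R\<^esub> = word_class R []"
  by (simp add: presented_group_def)

lemma presented_group_carrier: "carrier (presented_group R) = range (word_class R)"
  by (simp add: presented_group_def)

definition word_inv :: "'a word \<Rightarrow> 'a word" where
  "word_inv u = rev (map (\<lambda>(b, a). (\<not> b, a)) u)"

lemma word_eq_inv_left: "word_eq R (word_inv u @ u) []"
proof (induction u)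
  case Nil
  show ?case by (simp add: word_inv_def word_eq.refl)
next
  case (Cons x u)
  obtain b a where x: "x = (b, a)" by (cases x)
  have "word_eq R [(\<not> b, a), (b, a)] []"
    using word_eq.cancel[of R "\<not> b" a] by simp
  from word_eq.cong[OF this, of "word_inv u" u]
  have "word_eq R (word_inv (x # u) @ x # u) (word_inv u @ u)"
    by (simp add: word_inv_def x)
  with Cons show ?case by (blast intro: word_eq.trans)
qed

lemma presented_group_is_group: "group (presented_group R)"
proof (rule groupI)
  fix x assume "x \<in> carrier (presented_group R)"
  then obtain u where x: "x = word_class R u" by (auto simp: presented_group_carrier)
  have "word_class R (word_inv u) \<otimes>\<^bsub>presented_group R\<^esub> x = \<one>\<^bsub>presented_group R\<^esub>"
    by (simp add: x presented_group_mult presented_group_one word_class_eq_iff word_eq_inv_left)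
  then show "\<exists>y\<in>carrier (presented_group R). y \<otimes>\<^bsub>presented_group R\<^esub> x = \<one>\<^bsub>presented_group R\<^esub>"
    by (auto simp: presented_group_carrier)
qed (auto simp: presented_group_carrier presented_group_mult presented_group_one)

section \<open>Dihedral groups\<close>

datatype dihedral_gen = Rot | Ref

text \<open>The relations \<open>r\<^sup>m = 1\<close>, \<open>s\<^sup>2 = 1\<close> and \<open>s r s = r\<^sup>-\<^sup>1\<close>.\<close>

definition dihedral_rels :: "nat \<Rightarrow> (dihedral_gen word \<times> dihedral_gen word) set" where
  "dihedral_rels m =
     {(replicate m (True, Rot), []),
      ([(True, Ref), (True, Ref)], []),
      ([(True, Ref), (True, Rot), (True, Ref)], [(False, Rot)])}"

text \<open>
  The parameter is half the group order: \<open>dihedral_group m\<close> is $D_{2m}$. For \<open>m = 0\<close> the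
  presentation gives the infinite dihedral group.
\<close>

definition dihedral_group :: "nat \<Rightarrow> dihedral_gen word set monoid" where
  "dihedral_group m = presented_group (dihedral_rels m)"

definition dih_r :: "nat \<Rightarrow> dihedral_gen word set" where
  "dih_r m = word_class (dihedral_rels m) [(True, Rot)]"

definition dih_s :: "nat \<Rightarrow> dihedral_gen word set" where
  "dih_s m = word_class (dihedral_rels m) [(True, Ref)]"

lemma dihedral_group_is_group: "group (dihedral_group m)"
  by (simp add: dihedral_group_def presented_group_is_group)

lemma dih_r_closed: "dih_r m \<in> carrier (dihedral_group m)"
  and dih_s_closed: "dih_s m \<in> carrier (dihedral_group m)"
  by (simp_all add: dih_r_def dih_s_def dihedral_group_def presented_group_carrier)

lemma dih_r_inv: "inv\<^bsub>dihedral_group m\<^esub> dih_r m = word_class (dihedral_rels m) [(False, Rot)]"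
proof -
  interpret group "dihedral_group m" by (rule dihedral_group_is_group)
  show ?thesis
    by (rule inv_equality)
       (use word_eq.cancel[of "dihedral_rels m" False Rot] in
         \<open>auto simp: dih_r_def dihedral_group_def presented_group_mult presented_group_one
            presented_group_carrier word_class_eq_iff\<close>)
qed

lemma dih_relations:
  shows dih_r_pow: "dih_r m [^]\<^bsub>dihedral_group m\<^esub> m = \<one>\<^bsub>dihedral_group m\<^esub>"
    and dih_s_square: "dih_s m \<otimes>\<^bsub>dihedral_group m\<^esub> dih_s m = \<one>\<^bsub>dihedral_group m\<^esub>"
    and dih_srs: "dih_s m \<otimes>\<^bsub>dihedral_group m\<^esub> dih_r m \<otimes>\<^bsub>dihedral_group m\<^esub> dih_s m
                  = inv\<^bsub>dihedral_group m\<^esub> dih_r m"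
proof -
  interpret group "dihedral_group m" by (rule dihedral_group_is_group)
  have pow: "dih_r m [^]\<^bsub>dihedral_group m\<^esub> k
             = word_class (dihedral_rels m) (replicate k (True, Rot))" for k :: nat
    by (induction k)
       (simp_all add: dih_r_def dihedral_group_def presented_group_mult presented_group_one
          replicate_append_same)
  show "dih_r m [^]\<^bsub>dihedral_group m\<^esub> m = \<one>\<^bsub>dihedral_group m\<^esub>"
    unfolding pow
    by (auto simp: dihedral_group_def presented_group_one word_class_eq_iff dihedral_rels_def
        intro: word_eq.relation)
  show "dih_s m \<otimes>\<^bsub>dihedral_group m\<^esub> dih_s m = \<one>\<^bsub>dihedral_group m\<^esub>"
    by (auto simp: dih_s_def dihedral_group_def presented_group_one presented_group_mult
        word_class_eq_iff dihedral_rels_def intro: word_eq.relation)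
  show "dih_s m \<otimes>\<^bsub>dihedral_group m\<^esub> dih_r m \<otimes>\<^bsub>dihedral_group m\<^esub> dih_s m
        = inv\<^bsub>dihedral_group m\<^esub> dih_r m"
    unfolding dih_r_inv
    by (auto simp: dih_s_def dih_r_def dihedral_group_def presented_group_mult
        word_class_eq_iff dihedral_rels_def intro: word_eq.relation)
qed

lemma dih_generate: "generate (dihedral_group m) {dih_r m, dih_s m} = carrier (dihedral_group m)"
  (is "generate ?G ?S = _")
proof -
  interpret group ?G by (rule dihedral_group_is_group)
  let ?c = "word_class (dihedral_rels m)"
  have sinv: "inv\<^bsub>?G\<^esub> dih_s m = dih_s m"
    using dih_s_square dih_s_closed by (intro inv_equality) auto
  have sclass: "?c [(False, Ref)] = dih_s m"
  proof -
    have "?c [(False, Ref)] \<otimes>\<^bsub>?G\<^esub> dih_s m = \<one>\<^bsub>?G\<^esub>"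
      using word_eq.cancel[of "dihedral_rels m" False Ref]
      by (simp add: dih_s_def dihedral_group_def presented_group_mult presented_group_one
          word_class_eq_iff)
    from inv_equality[OF this dih_s_closed]
    show ?thesis using sinv by (simp add: dihedral_group_def presented_group_carrier)
  qed
  have letter: "?c [(b, a)] \<in> generate ?G ?S" for b a
  proof (cases a)
    case Rot
    show ?thesis
    proof (cases b)
      case True
      then show ?thesis using Rot generate.incl[of "dih_r m" ?S ?G] by (simp add: dih_r_def)
    next
      case False
      then show ?thesis using Rot generate.inv[of "dih_r m" ?S ?G] by (simp add: dih_r_inv)
    qed
  next
    case Ref
    have "?c [(b, a)] = dih_s m" using Ref sclass by (cases b) (simp_all add: dih_s_def)
    then show ?thesis using generate.incl[of "dih_s m" ?S ?G] by simp
  qed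
  have word: "?c u \<in> generate ?G ?S" for u
  proof (induction u)
    case Nil
    show ?case using generate.one[of ?G ?S] by (simp add: dihedral_group_def presented_group_one)
  next
    case (Cons x u)
    obtain b a where x: "x = (b, a)" by (cases x)
    show ?case
      using generate.eng[OF letter[of b a] Cons]
      by (simp add: x dihedral_group_def presented_group_mult)
  qed
  show ?thesis
  proof
    show "generate ?G ?S \<subseteq> carrier ?G"
      using dih_r_closed dih_s_closed by (intro generate_incl) auto
    show "carrier ?G \<subseteq> generate ?G ?S"
      using word by (auto simp: dihedral_group_def presented_group_carrier)
  qed
qed

text \<open>The universal property of the presentation.\<close>

lemma dihedral_group_universal:
  assumes "group H" "x \<in> carrier H" "y \<in> carrier H"
    and "x [^]\<^bsub>H\<^esub> m = \<one>\<^bsub>H\<^esub>" "y \<otimes>\<^bsub>H\<^esub> y = \<one>\<^bsub>H\<^esub>" "y \<otimes>\<^bsub>H\<^esub> x \<otimes>\<^bsub>H\<^esub> y = inv\<^bsub>H\<^esub> x"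
  shows "\<exists>f \<in> hom (dihedral_group m) H. f (dih_r m) = x \<and> f (dih_s m) = y"
proof -
  interpret group H by fact
  define gv where "gv a = (case a of Rot \<Rightarrow> x | Ref \<Rightarrow> y)" for a
  define lv where "lv p = (if fst p then gv (snd p) else inv\<^bsub>H\<^esub> (gv (snd p)))" for p
  define val where "val u = foldr (\<lambda>p z. lv p \<otimes>\<^bsub>H\<^esub> z) u \<one>\<^bsub>H\<^esub>" for u
  have gv: "gv a \<in> carrier H" for a using assms(2,3) by (cases a) (auto simp: gv_def)
  have lv: "lv p \<in> carrier H" for p using gv by (auto simp: lv_def)
  have val: "val u \<in> carrier H" for u by (induction u) (use lv in \<open>auto simp: val_def\<close>)
  have val_simps: "val [] = \<one>\<^bsub>H\<^esub>" "val (p # u) = lv p \<otimes>\<^bsub>H\<^esub> val u" for p u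
    by (simp_all add: val_def)
  have app: "val (u @ v) = val u \<otimes>\<^bsub>H\<^esub> val v" for u v
    by (induction u) (use lv val in \<open>auto simp: val_simps m_assoc\<close>)
  have rep: "val (replicate k (True, Rot)) = x [^]\<^bsub>H\<^esub> k" for k
  proof (induction k)
    case 0
    then show ?case by (simp add: val_simps)
  next
    case (Suc k)
    then show ?case using assms(2) nat_pow_Suc2[of x k] by (simp add: val_simps lv_def gv_def)
  qed
  have eq: "val u = val v" if "word_eq (dihedral_rels m) u v" for u v
    using that
  proof induction
    case (relation u v)
    then show ?case
      using assms(2-6) rep[of m]
      by (auto simp: dihedral_rels_def val_simps lv_def gv_def m_assoc)
  next
    case (cancel b a)
    then show ?case using gv[of a] by (auto simp: val_simps lv_def)
  qed (auto simp: app)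
  define f where "f A = val (SOME u. u \<in> A)" for A
  have f: "f (word_class (dihedral_rels m) u) = val u" for u
  proof -
    have "u \<in> word_class (dihedral_rels m) u" by (simp add: word_class_def word_eq.refl)
    then have "(SOME v. v \<in> word_class (dihedral_rels m) u) \<in> word_class (dihedral_rels m) u"
      by (rule someI)
    then show ?thesis using eq by (auto simp: f_def word_class_def)
  qed
  have "f \<in> hom (dihedral_group m) H"
    by (rule homI) (auto simp: dihedral_group_def presented_group_carrier presented_group_mult
        f val app)
  moreover have "f (dih_r m) = x" "f (dih_s m) = y"
    using assms(2,3) by (simp_all add: dih_r_def dih_s_def f val_simps lv_def gv_def)
  ultimately show ?thesis by blast
qed

section \<open>Notions of conjugacy for homomorphisms\<close>

definition generator_conjugate ::
  "'a set \<Rightarrow> ('b, 'c) monoid_scheme \<Rightarrow> ('a \<Rightarrow> 'b) \<Rightarrow> ('a \<Rightarrow> 'b) \<Rightarrow> bool" where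
  "generator_conjugate S H \<phi> \<psi> \<longleftrightarrow>
     (\<forall>g\<in>S. \<exists>h\<in>carrier H. h \<otimes>\<^bsub>H\<^esub> \<phi> g \<otimes>\<^bsub>H\<^esub> inv\<^bsub>H\<^esub> h = \<psi> g)"

definition element_conjugate ::
  "('a, 'd) monoid_scheme \<Rightarrow> ('b, 'c) monoid_scheme \<Rightarrow> ('a \<Rightarrow> 'b) \<Rightarrow> ('a \<Rightarrow> 'b) \<Rightarrow> bool" where
  "element_conjugate G H \<phi> \<psi> \<longleftrightarrow>
     (\<forall>g\<in>carrier G. \<exists>h\<in>carrier H. h \<otimes>\<^bsub>H\<^esub> \<phi> g \<otimes>\<^bsub>H\<^esub> inv\<^bsub>H\<^esub> h = \<psi> g)"

definition conjugate_homs ::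
  "('a, 'd) monoid_scheme \<Rightarrow> ('b, 'c) monoid_scheme \<Rightarrow> ('a \<Rightarrow> 'b) \<Rightarrow> ('a \<Rightarrow> 'b) \<Rightarrow> bool" where
  "conjugate_homs G H \<phi> \<psi> \<longleftrightarrow>
     (\<exists>h\<in>carrier H. \<forall>g\<in>carrier G. h \<otimes>\<^bsub>H\<^esub> \<phi> g \<otimes>\<^bsub>H\<^esub> inv\<^bsub>H\<^esub> h = \<psi> g)"

section \<open>Permutations and their cycles\<close>

text \<open>
  The symmetric group of a set of naturals; its elements are functions on all of \<open>nat\<close> fixing
  everything outside \<open>X\<close>, so for \<open>X \<subseteq> {1..n}\<close> its carrier is a subset of that of
  \<open>sym_group n\<close>.
\<close>

definition sym_group_on :: "nat set \<Rightarrow> (nat \<Rightarrow> nat) monoid" where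
  "sym_group_on X = \<lparr> carrier = {p. p permutes X}, monoid.mult = (\<circ>), monoid.one = id \<rparr>"

lemma sym_group_on_atLeastAtMost: "sym_group_on {1..n} = sym_group n"
  by (simp add: sym_group_on_def sym_group_def)

lemma sym_group_on_simps:
  "p \<in> carrier (sym_group_on X) \<longleftrightarrow> p permutes X"
  "p \<otimes>\<^bsub>sym_group_on X\<^esub> q = p \<circ> q"
  "\<one>\<^bsub>sym_group_on X\<^esub> = id"
  by (simp_all add: sym_group_on_def)

lemma sym_group_on_is_group: "group (sym_group_on X)"
proof (rule groupI)
  fix p assume "p \<in> carrier (sym_group_on X)"
  then have "Hilbert_Choice.inv p \<in> carrier (sym_group_on X)"
    "Hilbert_Choice.inv p \<otimes>\<^bsub>sym_group_on X\<^esub> p = \<one>\<^bsub>sym_group_on X\<^esub>"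
    by (simp_all add: sym_group_on_simps permutes_inv permutes_inv_o)
  then show "\<exists>q\<in>carrier (sym_group_on X). q \<otimes>\<^bsub>sym_group_on X\<^esub> p = \<one>\<^bsub>sym_group_on X\<^esub>"
    by blast
qed (auto simp: sym_group_on_simps permutes_compose permutes_id comp_assoc)

lemma sym_group_on_inv:
  assumes "p permutes X"
  shows "inv\<^bsub>sym_group_on X\<^esub> p = Hilbert_Choice.inv p"
proof -
  interpret group "sym_group_on X" by (rule sym_group_on_is_group)
  show ?thesis
    using assms
    by (intro inv_equality) (auto simp: sym_group_on_simps permutes_inv_o permutes_inv)
qed

lemma subgroup_sym_group_on:
  assumes "X \<subseteq> {1..n}"
  shows "subgroup (carrier (sym_group_on X)) (sym_group n)"
proof -
  interpret group "sym_group n" by (rule sym_group_is_group)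
  show ?thesis
  proof (rule subgroupI)
    show "carrier (sym_group_on X) \<subseteq> carrier (sym_group n)"
      using permutes_subset[OF _ assms] by (auto simp: sym_group_on_simps sym_group_carrier)
    have "id \<in> carrier (sym_group_on X)" by (simp add: sym_group_on_simps permutes_id)
    then show "carrier (sym_group_on X) \<noteq> {}" by blast
    fix p assume p: "p \<in> carrier (sym_group_on X)"
    then have "p permutes {1..n}"
      using permutes_subset[OF _ assms] by (auto simp: sym_group_on_simps)
    then show "inv\<^bsub>sym_group n\<^esub> p \<in> carrier (sym_group_on X)"
      using p sym_group_on_inv[of p "{1..n}", unfolded sym_group_on_atLeastAtMost]
      by (simp add: sym_group_on_simps permutes_inv)
    fix q assume "q \<in> carrier (sym_group_on X)"
    then show "p \<otimes>\<^bsub>sym_group n\<^esub> q \<in> carrier (sym_group_on X)"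
      using p by (simp add: sym_group_mult sym_group_on_simps permutes_compose)
  qed
qed

definition fix_set :: "nat \<Rightarrow> (nat \<Rightarrow> nat) \<Rightarrow> nat set" where
  "fix_set n \<sigma> = {x \<in> {1..n}. \<sigma> x = x}"

definition moved_set :: "nat \<Rightarrow> (nat \<Rightarrow> nat) \<Rightarrow> nat set" where
  "moved_set n \<sigma> = {1..n} - fix_set n \<sigma>"

definition comp_list :: "('a \<Rightarrow> 'a) list \<Rightarrow> 'a \<Rightarrow> 'a" where
  "comp_list ps = foldr (\<circ>) ps id"

text \<open>
  \<open>distinct (concat cs)\<close> says that every list in \<open>cs\<close> is a cycle and that the cycles are pairwise
  disjoint. Fixed points are not listed.
\<close>

definition disjoint_cycle_decomposition :: "('a \<Rightarrow> 'a) \<Rightarrow> 'a list list \<Rightarrow> bool" where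
  "disjoint_cycle_decomposition \<sigma> cs \<longleftrightarrow>
     (\<forall>c\<in>set cs. 2 \<le> length c) \<and> distinct (concat cs) \<and>
     \<sigma> = comp_list (map cycle_of_list cs)"

definition cycles_of_length :: "'a list list \<Rightarrow> nat \<Rightarrow> 'a \<Rightarrow> 'a" where
  "cycles_of_length cs k = comp_list (map cycle_of_list (filter (\<lambda>c. length c = k) cs))"

text \<open>
  \<open>restrict_id\<close> is the identity off \<open>X\<close>, so the component lies in \<open>sym_group_on X\<close> whenever the
  image of \<open>\<phi>\<close> preserves \<open>X\<close>.
\<close>

definition component :: "('a \<Rightarrow> nat \<Rightarrow> nat) \<Rightarrow> nat set \<Rightarrow> 'a \<Rightarrow> nat \<Rightarrow> nat" where
  "component \<phi> X = (\<lambda>g. restrict_id (\<phi> g) X)"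

text \<open>
  For a permutation \<open>\<tau>\<close> of \<open>{1..n}\<close>, the permutations of its moved points that conjugate it to a
  power of itself. The components on \<open>X\<^bsub>\<sigma>\<^sub>i\<^esub>\<close> take values here (lemma \<open>component_hom_H_group\<close>
  below), while their element-conjugacy is tested in \<open>S\<^bsub>X\<^esub>\<close>.
\<close>

definition H_group :: "nat \<Rightarrow> (nat \<Rightarrow> nat) \<Rightarrow> (nat \<Rightarrow> nat) monoid" where
  "H_group n \<tau> = (let S = sym_group_on (moved_set n \<tau>) in
     S\<lparr> carrier := {x \<in> carrier S. \<exists>z::int. x \<otimes>\<^bsub>S\<^esub> \<tau> \<otimes>\<^bsub>S\<^esub> inv\<^bsub>S\<^esub> x = \<tau> [^]\<^bsub>S\<^esub> z} \<rparr>)"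


subsection \<open>Cycle decompositions\<close>

lemma comp_list_simps:
  "comp_list [] = id" "comp_list (p # ps) = p \<circ> comp_list ps"
  by (simp_all add: comp_list_def)

lemma comp_list_cycles_outside:
  assumes "\<forall>c\<in>set cs. x \<notin> set c"
  shows "comp_list (map cycle_of_list cs) x = x"
  using assms by (induction cs) (auto simp: comp_list_simps id_outside_supp)

lemma comp_list_cycles_inside:
  assumes "distinct (concat cs)" "c \<in> set cs" "x \<in> set c"
  shows "comp_list (map cycle_of_list cs) x = cycle_of_list c x"
  using assms
proof (induction cs)
  case Nil
  then show ?case by simp
next
  case (Cons b cs)
  have d: "distinct (concat cs)" "set b \<inter> set (concat cs) = {}"
    using Cons.prems(1) by simp_all
  show ?case
  proof (cases "c \<in> set cs")
    case True
    have "cycle_of_list c x \<in> set c"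
      using permutes_in_image[OF cycle_permutes] Cons.prems(3) by metis
    then have "cycle_of_list c x \<notin> set b" using True d(2) by auto
    then show ?thesis
      using Cons.IH[OF d(1) True Cons.prems(3)] by (simp add: comp_list_simps id_outside_supp)
  next
    case False
    then have c: "c = b" using Cons.prems(2) by simp
    have "\<forall>a\<in>set cs. x \<notin> set a" using d(2) Cons.prems(3) c by auto
    then show ?thesis using c by (simp add: comp_list_simps comp_list_cycles_outside)
  qed
qed

lemma exists_disjoint_cycle_decomposition:
  assumes "\<sigma> permutes S" "finite S"
  shows "\<exists>cs. disjoint_cycle_decomposition \<sigma> cs"
proof -
  have "\<exists>cs. (\<forall>c\<in>set cs. 2 \<le> length c) \<and> distinct (concat cs) \<and> set (concat cs) \<subseteq> I \<and>
          p = comp_list (map cycle_of_list cs)" if "cycle_decomp I p" for I and p :: "'a \<Rightarrow> 'a"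
    using that
  proof induction
    case empty
    show ?case by (rule exI[of _ "[]"]) (simp add: comp_list_simps)
  next
    case (comp I p c)
    from comp.IH obtain cs where cs: "\<forall>c\<in>set cs. 2 \<le> length c" "distinct (concat cs)"
      "set (concat cs) \<subseteq> I" "p = comp_list (map cycle_of_list cs)" by blast
    show ?case
    proof (cases "2 \<le> length c")
      case True
      with cs comp.hyps show ?thesis
        by (intro exI[of _ "c # cs"]) (auto simp: comp_list_simps)
    next
      case False
      then have "cycle_of_list c = id" by (cases c rule: cycle_of_list.cases) auto
      with cs show ?thesis by (intro exI[of _ cs]) auto
    qed
  qed
  with cycle_decomposition[OF assms] show ?thesis
    unfolding disjoint_cycle_decomposition_def by blast
qed

lemma decomposition_funpow_iff:
  assumes "disjoint_cycle_decomposition \<sigma> cs" "c \<in> set cs" "x \<in> set c"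
  shows "(\<sigma> ^^ k) x = x \<longleftrightarrow> length c dvd k"
proof -
  have d: "distinct (concat cs)" and \<sigma>: "\<sigma> = comp_list (map cycle_of_list cs)"
    using assms(1) by (auto simp: disjoint_cycle_decomposition_def)
  have c: "cycle c" using d assms(2) by (simp add: distinct_concat_iff)
  have step: "\<sigma> y = cycle_of_list c y" if "y \<in> set c" for y
    using comp_list_cycles_inside[OF d assms(2) that] \<sigma> by simp
  have closed: "cycle_of_list c y \<in> set c" if "y \<in> set c" for y
    using permutes_in_image[OF cycle_permutes] that by metis
  have pow: "(\<sigma> ^^ k) x = (cycle_of_list c ^^ k) x \<and> (cycle_of_list c ^^ k) x \<in> set c" for k
  proof (induction k)
    case 0
    then show ?case using assms(3) by simp
  next
    case (Suc k)
    then show ?case using step[of "(cycle_of_list c ^^ k) x"] closed[of "(cycle_of_list c ^^ k) x"] by simp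
  qed
  obtain i where i: "i < length c" "x = c ! i" using assms(3) by (auto simp: in_set_conv_nth)
  have "(cycle_of_list c ^^ k) x = rotate k c ! i"
    using arg_cong[OF cyclic_rotation[OF c, of k], of "\<lambda>ys. ys ! i"] i by simp
  also have "\<dots> = c ! ((k + i) mod length c)" using i(1) by (simp add: nth_rotate)
  finally have "(\<sigma> ^^ k) x = x \<longleftrightarrow> c ! ((k + i) mod length c) = c ! i"
    using pow[of k] i(2) by metis
  also have "\<dots> \<longleftrightarrow> (k + i) mod length c = i"
    by (rule nth_eq_iff_index_eq[OF c _ i(1)]) (rule mod_less_divisor, use i(1) in linarith)
  also have "\<dots> \<longleftrightarrow> length c dvd k"
  proof -
    have "(k + i) mod length c = i \<longleftrightarrow> (i + k) mod length c = i mod length c"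
      using i(1) by (simp add: add.commute)
    also have "\<dots> \<longleftrightarrow> length c dvd k"
      using mod_eq_dvd_iff_nat[of i "i + k" "length c"] by simp
    finally show ?thesis .
  qed
  finally show ?thesis .
qed

lemma decomposition_fixed:
  assumes "disjoint_cycle_decomposition \<sigma> cs" "\<forall>c\<in>set cs. x \<notin> set c"
  shows "\<sigma> x = x"
  using assms comp_list_cycles_outside[of cs x] by (simp add: disjoint_cycle_decomposition_def)

lemma cycles_of_length_apply:
  assumes "disjoint_cycle_decomposition \<sigma> cs"
  shows "cycles_of_length cs k = restrict_id \<sigma> {x. \<exists>c\<in>set cs. length c = k \<and> x \<in> set c}"
proof
  fix x
  let ?cs = "filter (\<lambda>c. length c = k) cs"
  have d: "distinct (concat cs)" using assms by (simp add: disjoint_cycle_decomposition_def)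
  have d': "distinct (concat ?cs)"
    using d by (induction cs) auto
  show "cycles_of_length cs k x = restrict_id \<sigma> {x. \<exists>c\<in>set cs. length c = k \<and> x \<in> set c} x"
  proof (cases "\<exists>c\<in>set cs. length c = k \<and> x \<in> set c")
    case True
    then obtain c where c: "c \<in> set cs" "length c = k" "x \<in> set c" by blast
    then show ?thesis
      using comp_list_cycles_inside[OF d' _ c(3)] comp_list_cycles_inside[OF d c(1,3)] assms
      by (auto simp: cycles_of_length_def restrict_id_def disjoint_cycle_decomposition_def)
  next
    case False
    then show ?thesis
      using comp_list_cycles_outside[of ?cs x] by (auto simp: cycles_of_length_def restrict_id_def)
  qed
qed

lemma cycle_points_iff:
  assumes "disjoint_cycle_decomposition \<sigma> cs" "2 \<le> k"
  shows "(\<exists>c\<in>set cs. length c = k \<and> x \<in> set c) \<longleftrightarrow> (\<forall>j. (\<sigma> ^^ j) x = x \<longleftrightarrow> k dvd j)"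
proof (cases "\<exists>c\<in>set cs. x \<in> set c")
  case True
  then obtain c where c: "c \<in> set cs" "x \<in> set c" by blast
  have "(\<forall>j. (\<sigma> ^^ j) x = x \<longleftrightarrow> k dvd j) \<longleftrightarrow> length c = k"
    using decomposition_funpow_iff[OF assms(1) c] by (metis dvd_antisym dvd_refl)
  moreover have "b = c" if "b \<in> set cs" "x \<in> set b" for b
    using that c assms(1) unfolding disjoint_cycle_decomposition_def distinct_concat_iff by blast
  ultimately show ?thesis using c by blast
next
  case False
  then have "\<sigma> x = x" using decomposition_fixed[OF assms(1)] by blast
  then have "\<not> (\<forall>j. (\<sigma> ^^ j) x = x \<longleftrightarrow> k dvd j)"
    using assms(2) by (intro notI) (auto dest: spec[of _ "1::nat"])
  then show ?thesis using False by blast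
qed

lemma moved_set_cycles_of_length:
  assumes "disjoint_cycle_decomposition \<sigma> cs" "2 \<le> k" "\<sigma> permutes {1..n}"
  shows "moved_set n (cycles_of_length cs k) = {x. \<forall>j. (\<sigma> ^^ j) x = x \<longleftrightarrow> k dvd j}"
    and "cycles_of_length cs k = restrict_id \<sigma> (moved_set n (cycles_of_length cs k))"
proof -
  have eq: "cycles_of_length cs k = restrict_id \<sigma> {x. \<forall>j. (\<sigma> ^^ j) x = x \<longleftrightarrow> k dvd j}"
    using cycles_of_length_apply[OF assms(1), of k] cycle_points_iff[OF assms(1,2)] by simp
  have mv: "\<sigma> x \<noteq> x" if "\<forall>j. (\<sigma> ^^ j) x = x \<longleftrightarrow> k dvd j" for x
    using that[rule_format, of 1] assms(2) by auto
  moreover have "x \<in> {1..n}" if "\<forall>j. (\<sigma> ^^ j) x = x \<longleftrightarrow> k dvd j" for x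
    using mv[OF that] permutes_not_in[OF assms(3)] by blast
  ultimately show 1: "moved_set n (cycles_of_length cs k) = {x. \<forall>j. (\<sigma> ^^ j) x = x \<longleftrightarrow> k dvd j}"
    unfolding eq moved_set_def fix_set_def restrict_id_def by auto
  show "cycles_of_length cs k = restrict_id \<sigma> (moved_set n (cycles_of_length cs k))"
    unfolding 1 by (rule eq)
qed

subsection \<open>The components are homomorphisms into \<open>S\<^bsub>Fix \<sigma>\<^esub>\<close> and \<open>H\<close>\<close>

lemma (in group) generate_conj_rotation:
  assumes r: "r \<in> carrier G" and s: "s \<in> carrier G"
    and ss: "s \<otimes> s = \<one>" and srs: "s \<otimes> r \<otimes> s = inv r"
    and g: "g \<in> generate G {r, s}"
  shows "g \<in> carrier G \<and> (\<exists>y\<in>{r, inv r}. g \<otimes> r = y \<otimes> g)"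
proof -
  have sr: "s \<otimes> r = inv r \<otimes> s"
    using srs ss r s by (metis m_assoc m_closed r_one)
  have sinv: "inv s = s" using ss s by (metis inv_equality)
  have inv_case: "g \<otimes> inv r = inv x \<otimes> g"
    if "g \<in> carrier G" "x \<in> carrier G" "g \<otimes> r = x \<otimes> g" for g x
  proof -
    have "g \<otimes> inv r = inv x \<otimes> x \<otimes> g \<otimes> inv r" using that(1,2) by (simp only: l_inv l_one)
    also have "\<dots> = inv x \<otimes> (g \<otimes> r) \<otimes> inv r"
      unfolding that(3) using that(1,2) r by (simp only: m_assoc m_closed inv_closed)
    also have "\<dots> = inv x \<otimes> g" using that(1,2) r by (simp add: m_assoc)
    finally show ?thesis .
  qed
  show ?thesis
    using g
  proof induction
    case one
    then show ?case using r by simp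
  next
    case (incl h)
    then show ?case using r s sr by auto
  next
    case (inv h)
    then show ?case using r s sr sinv by auto
  next
    case (eng h1 h2)
    then have h: "h1 \<in> carrier G" "h2 \<in> carrier G" by auto
    obtain y where y: "y \<in> {r, inv r}" "h2 \<otimes> r = y \<otimes> h2" using eng by blast
    obtain x where x: "x \<in> {r, inv r}" "h1 \<otimes> r = x \<otimes> h1" using eng by blast
    have "\<exists>z\<in>{r, inv r}. h1 \<otimes> y = z \<otimes> h1"
    proof (cases "y = r")
      case True
      with x show ?thesis by blast
    next
      case False
      have "h1 \<otimes> y = inv x \<otimes> h1" using False y(1) x r inv_case[OF h(1), of x] by auto
      moreover have "inv x \<in> {r, inv r}" using x(1) r by auto
      ultimately show ?thesis by blast
    qed
    then obtain z where z: "z \<in> {r, inv r}" "h1 \<otimes> y = z \<otimes> h1" by blast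
    have c: "y \<in> carrier G" "z \<in> carrier G" using y(1) z(1) r by auto
    have "h1 \<otimes> h2 \<otimes> r = h1 \<otimes> y \<otimes> h2" using h r c y(2) by (simp add: m_assoc)
    also have "\<dots> = z \<otimes> (h1 \<otimes> h2)" using h c z(2) by (simp add: m_assoc)
    finally show ?case using z(1) h by blast
  qed
qed

lemma dihedral_conj_rotation:
  assumes "g \<in> carrier (dihedral_group m)"
  shows "g \<otimes>\<^bsub>dihedral_group m\<^esub> dih_r m = dih_r m \<otimes>\<^bsub>dihedral_group m\<^esub> g \<or>
    g \<otimes>\<^bsub>dihedral_group m\<^esub> dih_r m = inv\<^bsub>dihedral_group m\<^esub> dih_r m \<otimes>\<^bsub>dihedral_group m\<^esub> g"
  using group.generate_conj_rotation[OF dihedral_group_is_group dih_r_closed dih_s_closed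
      dih_s_square dih_srs] assms
  unfolding dih_generate by blast

lemma hom_image_commutes:
  assumes "\<phi> \<in> hom (dihedral_group m) (sym_group n)" "\<phi> (dih_r m) = \<sigma>"
    and "g \<in> carrier (dihedral_group m)"
  shows "\<phi> g \<circ> \<sigma> = \<sigma> \<circ> \<phi> g \<or> \<phi> g \<circ> \<sigma> = Hilbert_Choice.inv \<sigma> \<circ> \<phi> g"
proof -
  interpret G: group "dihedral_group m" by (rule dihedral_group_is_group)
  interpret S: group "sym_group n" by (rule sym_group_is_group)
  interpret \<phi>: group_hom "dihedral_group m" "sym_group n" \<phi>
    using assms(1) by unfold_locales
  have \<sigma>: "\<sigma> permutes {1..n}"
    using \<phi>.hom_closed[OF dih_r_closed] assms(2) by (simp add: sym_group_carrier)
  have inv: "\<phi> (inv\<^bsub>dihedral_group m\<^esub> dih_r m) = Hilbert_Choice.inv \<sigma>"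
    using \<phi>.hom_inv[OF dih_r_closed] assms(2)
      sym_group_on_inv[OF \<sigma>, unfolded sym_group_on_atLeastAtMost]
    by simp
  from dihedral_conj_rotation[OF assms(3)] show ?thesis
    using \<phi>.hom_mult[OF assms(3) dih_r_closed] \<phi>.hom_mult[OF dih_r_closed assms(3)]
      \<phi>.hom_mult[OF G.inv_closed[OF dih_r_closed] assms(3)] assms(2) inv
    by (auto simp: sym_group_mult)
qed

lemma commute_funpow:
  assumes "p \<circ> \<sigma> = \<tau> \<circ> p"
  shows "(\<tau> ^^ k) (p x) = p ((\<sigma> ^^ k) x)"
  by (induction k) (use assms in \<open>auto simp: fun_eq_iff\<close>)

lemma hom_image_period:
  assumes "\<phi> \<in> hom (dihedral_group m) (sym_group n)" "\<phi> (dih_r m) = \<sigma>"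
    and "g \<in> carrier (dihedral_group m)"
  shows "(\<sigma> ^^ k) (\<phi> g x) = \<phi> g x \<longleftrightarrow> (\<sigma> ^^ k) x = x"
proof -
  have p: "\<phi> g permutes {1..n}" and \<sigma>: "\<sigma> permutes {1..n}"
    using hom_in_carrier[OF assms(1) assms(3)] hom_in_carrier[OF assms(1) dih_r_closed] assms(2)
    by (simp_all add: sym_group_carrier)
  have inj: "inj (\<phi> g)" and bij: "bij \<sigma>" using p \<sigma> by (auto intro: permutes_inj permutes_bij)
  have inv_iff: "(Hilbert_Choice.inv \<sigma> ^^ k) y = y \<longleftrightarrow> (\<sigma> ^^ k) y = y" for y
  proof -
    have "(\<sigma> ^^ k) ((Hilbert_Choice.inv \<sigma> ^^ k) y) = y" "(Hilbert_Choice.inv \<sigma> ^^ k) ((\<sigma> ^^ k) y) = y"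
      using bij by (metis inv_fn bij_fn bij_inv_eq_iff)+
    then show ?thesis by metis
  qed
  from hom_image_commutes[OF assms] show ?thesis
    using commute_funpow[of "\<phi> g" \<sigma> \<sigma> k x]
      commute_funpow[of "\<phi> g" \<sigma> "Hilbert_Choice.inv \<sigma>" k x] inv_iff[of "\<phi> g x"] inj
    by (auto simp: inj_eq)
qed

lemma restrict_id_permutes:
  assumes "bij p" "\<And>x. p x \<in> X \<longleftrightarrow> x \<in> X"
  shows "restrict_id p X permutes X"
proof (rule bij_imp_permutes)
  have "p ` X = X"
  proof
    show "p ` X \<subseteq> X" using assms(2) by blast
    show "X \<subseteq> p ` X"
    proof
      fix x assume "x \<in> X"
      moreover obtain y where "x = p y" using bij_is_surj[OF assms(1)] by (rule surjE)
      ultimately show "x \<in> p ` X" using assms(2) by blast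
    qed
  qed
  then show "bij_betw (restrict_id p X) X X"
    using inj_on_subset[OF bij_is_inj[OF assms(1)], of X]
    by (simp add: bij_betw_def restrict_id_def inj_on_def image_def)
qed (simp add: restrict_id_def)

lemma component_hom:
  assumes "\<phi> \<in> hom (dihedral_group m) (sym_group n)"
    and "\<And>g x. g \<in> carrier (dihedral_group m) \<Longrightarrow> \<phi> g x \<in> X \<longleftrightarrow> x \<in> X"
  shows "component \<phi> X \<in> hom (dihedral_group m) (sym_group_on X)"
proof (rule homI)
  fix g assume g: "g \<in> carrier (dihedral_group m)"
  have "bij (\<phi> g)"
    using hom_in_carrier[OF assms(1) g] permutes_bij by (simp add: sym_group_carrier)
  from restrict_id_permutes[OF this assms(2)[OF g]]
  show "component \<phi> X g \<in> carrier (sym_group_on X)"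
    by (simp add: component_def sym_group_on_simps)
  fix h assume h: "h \<in> carrier (dihedral_group m)"
  have "restrict_id (\<phi> g \<circ> \<phi> h) X x = restrict_id (\<phi> g) X (restrict_id (\<phi> h) X x)" for x
    using assms(2)[OF h, of x] by (simp add: restrict_id_def)
  then show "component \<phi> X (g \<otimes>\<^bsub>dihedral_group m\<^esub> h) =
        component \<phi> X g \<otimes>\<^bsub>sym_group_on X\<^esub> component \<phi> X h"
    using hom_mult[OF assms(1) g h]
    by (simp add: component_def sym_group_on_simps sym_group_mult fun_eq_iff)
qed

lemma component_hom_fix_set:
  assumes "\<phi> \<in> hom (dihedral_group m) (sym_group n)" "\<phi> (dih_r m) = \<sigma>"
  shows "component \<phi> (fix_set n \<sigma>) \<in> hom (dihedral_group m) (sym_group_on (fix_set n \<sigma>))"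
proof (rule component_hom[OF assms(1)])
  fix g x assume g: "g \<in> carrier (dihedral_group m)"
  have "\<phi> g permutes {1..n}" using hom_in_carrier[OF assms(1) g] by (simp add: sym_group_carrier)
  from permutes_in_image[OF this, of x]
  show "\<phi> g x \<in> fix_set n \<sigma> \<longleftrightarrow> x \<in> fix_set n \<sigma>"
    using hom_image_period[OF assms g, of 1 x] by (auto simp: fix_set_def)
qed

lemma component_hom_H_group:
  assumes "\<phi> \<in> hom (dihedral_group m) (sym_group n)" "\<phi> (dih_r m) = \<sigma>"
    and "disjoint_cycle_decomposition \<sigma> cs" "2 \<le> k"
  defines "\<tau> \<equiv> cycles_of_length cs k"
  shows "component \<phi> (moved_set n \<tau>) \<in> hom (dihedral_group m) (H_group n \<tau>)"
proof -
  let ?X = "moved_set n \<tau>"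
  let ?S = "sym_group_on ?X"
  interpret S: group ?S by (rule sym_group_on_is_group)
  have \<sigma>: "\<sigma> permutes {1..n}"
    using hom_in_carrier[OF assms(1) dih_r_closed] assms(2) by (simp add: sym_group_carrier)
  have X: "?X = {x. \<forall>j. (\<sigma> ^^ j) x = x \<longleftrightarrow> k dvd j}"
    and \<tau>: "\<tau> = restrict_id \<sigma> ?X"
    using moved_set_cycles_of_length[OF assms(3,4) \<sigma>] by (simp_all add: \<tau>_def)
  have inX: "\<phi> g x \<in> ?X \<longleftrightarrow> x \<in> ?X" if "g \<in> carrier (dihedral_group m)" for g x
    using hom_image_period[OF assms(1,2) that] by (simp add: X)
  have hom: "component \<phi> ?X \<in> hom (dihedral_group m) ?S"
    by (rule component_hom[OF assms(1) inX])
  have "component \<phi> ?X (dih_r m) = \<tau>" using assms(2) \<tau> by (simp add: component_def)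
  with hom_in_carrier[OF hom dih_r_closed] have \<tau>S: "\<tau> \<in> carrier ?S" by simp
  interpret c: group_hom "dihedral_group m" ?S "component \<phi> ?X"
    using hom dihedral_group_is_group by (simp add: group_hom_def group_hom_axioms_def S.group_axioms)
  have "component \<phi> ?X g \<in> carrier (H_group n \<tau>)" if g: "g \<in> carrier (dihedral_group m)" for g
  proof -
    let ?x = "component \<phi> ?X g"
    have x: "?x \<in> carrier ?S" using hom_in_carrier[OF hom g] .
    have "?x \<otimes>\<^bsub>?S\<^esub> \<tau> = \<tau> \<otimes>\<^bsub>?S\<^esub> ?x \<or> ?x \<otimes>\<^bsub>?S\<^esub> \<tau> = inv\<^bsub>?S\<^esub> \<tau> \<otimes>\<^bsub>?S\<^esub> ?x"
      using dihedral_conj_rotation[OF g] c.hom_mult[OF g dih_r_closed] c.hom_mult[OF dih_r_closed g]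
        c.hom_mult[OF group.inv_closed[OF dihedral_group_is_group dih_r_closed] g] c.hom_inv[OF dih_r_closed]
        \<open>component \<phi> ?X (dih_r m) = \<tau>\<close> by metis
    then have "?x \<otimes>\<^bsub>?S\<^esub> \<tau> \<otimes>\<^bsub>?S\<^esub> inv\<^bsub>?S\<^esub> ?x = \<tau> [^]\<^bsub>?S\<^esub> (1::int) \<or>
               ?x \<otimes>\<^bsub>?S\<^esub> \<tau> \<otimes>\<^bsub>?S\<^esub> inv\<^bsub>?S\<^esub> ?x = \<tau> [^]\<^bsub>?S\<^esub> (- 1::int)"
      using x \<tau>S S.inv_solve_right' S.int_pow_neg[of \<tau> 1] S.int_pow_1[of \<tau>] by auto
    then show ?thesis using x by (auto simp: H_group_def Let_def)
  qed
  then show ?thesis using hom by (auto simp: hom_def H_group_def Let_def)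
qed

end

theory Submission
  imports Defs "HOL-Algebra.Group_Action"
begin

text \<open>
  Through \<open>\<phi>\<close> and \<open>\<psi>\<close> the dihedral group acts on \<open>{1..n}\<close> in two ways, and a permutation that
  conjugates \<open>\<phi>\<close> to \<open>\<psi>\<close> is the same thing as an equivariant bijection between these two sets with
  action. Two finite sets with an action of \<open>G\<close> are isomorphic as soon as, for every \<open>H\<close>, they have
  equally many points whose stabilizer is exactly \<open>H\<close>: match orbits of points with equal stabilizer
  (\<open>equivariant_bij_if_stabilizer_counts\<close>).

  For the dihedral group these numbers can be read off from fixed points of single elements. Let \<open>R\<close>
  be the subgroup of rotations; it has index at most two. A subgroup \<open>H\<close> that contains some \<open>t\<close>
  outside \<open>R\<close> is determined by \<open>t\<close> and \<open>H \<inter> R\<close>, so the points with stabilizer \<open>H\<close> are the fixed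
  points of \<open>t\<close> among the points whose stabilizer meets \<open>R\<close> in \<open>H \<inter> R\<close>. A stabilizer \<open>H\<close> inside \<open>R\<close>
  accounts for all the remaining points whose stabilizer meets \<open>R\<close> in \<open>H\<close>. Hence it suffices that
  every group element has equally many fixed points under both actions on each set of points with
  prescribed stabilizer in \<open>R\<close> (\<open>stabilizer_counts_if_index2\<close>).

  The rotations act through the powers of \<open>\<sigma>\<close> in both cases, so the stabilizer of a point in \<open>R\<close>
  records its period under \<open>\<sigma>\<close>, and the sets just mentioned are \<open>Fix \<sigma>\<close> and the moved sets of the
  factors \<open>\<sigma>\<^sub>i\<close>. Element-conjugacy of the components gives equal numbers of fixed points on them.
  The bijection arises on all of \<open>{1..n}\<close> at once, so nothing has to be glued.

  Conversely, a permutation that conjugates \<open>\<phi>\<close> to \<open>\<psi>\<close> commutes with \<open>\<sigma> = \<phi> r = \<psi> r\<close>. It therefore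
  preserves periods, and its restrictions conjugate the components.
\<close>

section \<open>Finite sets with a group action\<close>

locale finite_action = group G for G (structure) +
  fixes act :: "'a \<Rightarrow> 'x \<Rightarrow> 'x" and X :: "'x set"
  assumes finite_points: "finite X"
    and act_closed: "\<lbrakk>g \<in> carrier G; x \<in> X\<rbrakk> \<Longrightarrow> act g x \<in> X"
    and act_one: "x \<in> X \<Longrightarrow> act \<one> x = x"
    and act_mult: "\<lbrakk>g \<in> carrier G; h \<in> carrier G; x \<in> X\<rbrakk> \<Longrightarrow> act (g \<otimes> h) x = act g (act h x)"
begin

lemma act_inv_cancel:
  assumes "g \<in> carrier G" "x \<in> X"
  shows "act (inv g) (act g x) = x" "act g (act (inv g) x) = x"
  using assms act_mult[of "inv g" g x] act_mult[of g "inv g" x] by (simp_all add: act_one)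

lemma act_eq_iff_stabilizer:
  assumes "g \<in> carrier G" "h \<in> carrier G" "x \<in> X"
  shows "act g x = act h x \<longleftrightarrow> inv h \<otimes> g \<in> stabilizer G act x"
proof -
  have "act (inv h \<otimes> g) x = act (inv h) (act g x)" using assms by (simp add: act_mult)
  then show ?thesis
    using assms act_inv_cancel(1)[OF assms(2,3)] act_inv_cancel(2)[OF assms(2), of "act g x"]
    by (auto simp: stabilizer_def act_closed)
qed

lemma subgroup_stabilizer:
  assumes "x \<in> X"
  shows "subgroup (stabilizer G act x) G"
proof (rule subgroupI)
  show "stabilizer G act x \<noteq> {}" using act_one[OF assms] by (auto simp: stabilizer_def)
  fix g assume g: "g \<in> stabilizer G act x"
  then show "inv g \<in> stabilizer G act x"
    using act_inv_cancel(1)[of g x] assms by (auto simp: stabilizer_def)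
  fix h assume "h \<in> stabilizer G act x"
  with g show "g \<otimes> h \<in> stabilizer G act x" using assms by (auto simp: stabilizer_def act_mult)
qed (auto simp: stabilizer_def)

lemma self_in_orbit:
  assumes "x \<in> X"
  shows "x \<in> orbit G act x"
  using act_one[OF assms] by (force simp: orbit_def)

lemma orbit_subset: "x \<in> X \<Longrightarrow> orbit G act x \<subseteq> X"
  by (auto simp: orbit_def act_closed)

lemma act_in_orbit_iff:
  assumes "x \<in> X" "z \<in> X" "g \<in> carrier G"
  shows "act g z \<in> orbit G act x \<longleftrightarrow> z \<in> orbit G act x"
proof
  assume "act g z \<in> orbit G act x"
  then obtain k where "k \<in> carrier G" "act g z = act k x" by (auto simp: orbit_def)
  then have "z = act (inv g \<otimes> k) x" "inv g \<otimes> k \<in> carrier G"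
    using assms act_inv_cancel(1)[of g z] by (auto simp: act_mult)
  then show "z \<in> orbit G act x" unfolding orbit_def by blast
next
  assume "z \<in> orbit G act x"
  then obtain k where "k \<in> carrier G" "z = act k x" by (auto simp: orbit_def)
  then have "act g z = act (g \<otimes> k) x" "g \<otimes> k \<in> carrier G"
    using assms by (auto simp: act_mult)
  then show "act g z \<in> orbit G act x" unfolding orbit_def by blast
qed

lemma remove_orbit:
  assumes "x \<in> X"
  shows "finite_action G act (X - orbit G act x)"
  by unfold_locales
     (use assms finite_points in \<open>auto simp: act_closed act_one act_mult act_in_orbit_iff\<close>)

end

text \<open>
  Both orbits are the set of left cosets of the common stabilizer, which makes
  \<open>act g x \<mapsto> act' g y\<close> well defined and injective.
\<close>

lemma equivariant_bij_orbits:
  assumes "finite_action G act X" "finite_action G act' Y"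
    and x: "x \<in> X" and y: "y \<in> Y" and stab: "stabilizer G act x = stabilizer G act' y"
  shows "\<exists>f. bij_betw f (orbit G act x) (orbit G act' y) \<and>
    (\<forall>g\<in>carrier G. \<forall>z\<in>orbit G act x. f (act g z) = act' g (f z))"
proof -
  interpret A: finite_action G act X by fact
  interpret B: finite_action G act' Y by fact
  define f where "f z = act' (SOME g. g \<in> carrier G \<and> z = act g x) y" for z
  have f: "f (act g x) = act' g y" if g: "g \<in> carrier G" for g
  proof -
    let ?h = "SOME h. h \<in> carrier G \<and> act g x = act h x"
    have "?h \<in> carrier G \<and> act g x = act ?h x" by (rule someI[of _ g]) (use g in simp)
    then show ?thesis
      using A.act_eq_iff_stabilizer[of g ?h x] B.act_eq_iff_stabilizer[of g ?h y] g x y stab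
      by (simp add: f_def)
  qed
  have "bij_betw f (orbit G act x) (orbit G act' y)"
  proof (rule bij_betw_imageI)
    show "inj_on f (orbit G act x)"
    proof (rule inj_onI)
      fix z w assume "z \<in> orbit G act x" "w \<in> orbit G act x" "f z = f w"
      then obtain g h where gh: "g \<in> carrier G" "h \<in> carrier G" "z = act g x" "w = act h x"
        by (auto simp: orbit_def)
      with \<open>f z = f w\<close> have "act' g y = act' h y" by (simp add: f)
      then show "z = w"
        using A.act_eq_iff_stabilizer[of g h x] B.act_eq_iff_stabilizer[of g h y] gh x y stab by simp
    qed
    show "f ` orbit G act x = orbit G act' y"
      by (auto simp: orbit_def f image_def)
  qed
  moreover have "f (act g z) = act' g (f z)" if g: "g \<in> carrier G" and z: "z \<in> orbit G act x" for g z
  proof -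
    obtain k where k: "k \<in> carrier G" "z = act k x" using z by (auto simp: orbit_def)
    then show ?thesis
      using g x y f[of "g \<otimes>\<^bsub>G\<^esub> k"] by (simp add: f A.act_mult B.act_mult)
  qed
  ultimately show ?thesis by blast
qed

lemma equivariant_bij_stabilizer:
  assumes "bij_betw f X Y" "\<forall>g\<in>carrier G. \<forall>z\<in>X. act g z \<in> X \<and> f (act g z) = act' g (f z)"
    and "z \<in> X"
  shows "stabilizer G act' (f z) = stabilizer G act z"
proof -
  have "act' g (f z) = f z \<longleftrightarrow> act g z = z" if "g \<in> carrier G" for g
    using assms that bij_betw_imp_inj_on[OF assms(1)] by (metis inj_on_eq_iff)
  then show ?thesis by (auto simp: stabilizer_def)
qed

lemma equivariant_bij_card_stabilizer:
  assumes "bij_betw f X Y" "\<forall>g\<in>carrier G. \<forall>z\<in>X. act g z \<in> X \<and> f (act g z) = act' g (f z)"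
  shows "card {z\<in>X. stabilizer G act z = H} = card {z\<in>Y. stabilizer G act' z = H}"
proof (rule bij_betw_same_card)
  have st: "stabilizer G act' (f z) = stabilizer G act z" if "z \<in> X" for z
    by (rule equivariant_bij_stabilizer[OF assms that])
  show "bij_betw f {z\<in>X. stabilizer G act z = H} {z\<in>Y. stabilizer G act' z = H}"
    using assms(1) st unfolding bij_betw_def by (auto simp: inj_on_def)
qed

text \<open>
  The induction removes from each set one orbit, chosen so that the two base points have equal
  stabilizers. The removed orbits are isomorphic, hence contribute equally to each count, and the
  hypothesis passes to the complements.
\<close>

lemma equivariant_bij_if_stabilizer_counts:
  assumes "finite_action G act X" "finite_action G act' Y"
    and "\<And>H. card {x\<in>X. stabilizer G act x = H} = card {y\<in>Y. stabilizer G act' y = H}"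
  shows "\<exists>f. bij_betw f X Y \<and> (\<forall>g\<in>carrier G. \<forall>x\<in>X. f (act g x) = act' g (f x))"
  using assms
proof (induction "card X" arbitrary: X Y rule: less_induct)
  case less
  interpret A: finite_action G act X by fact
  interpret B: finite_action G act' Y by fact
  show ?case
  proof (cases "X = {}")
    case True
    have "Y = {}"
    proof (rule ccontr)
      assume "Y \<noteq> {}"
      then obtain y where "y \<in> Y" by blast
      with less.prems(3)[of "stabilizer G act' y"] True B.finite_points show False by auto
    qed
    with True show ?thesis by (intro exI[of _ undefined]) (simp add: bij_betw_def)
  next
    case False
    then obtain x where x: "x \<in> X" by blast
    then have "card {z\<in>X. stabilizer G act z = stabilizer G act x} \<noteq> 0"
      using A.finite_points by auto
    then have "{z\<in>Y. stabilizer G act' z = stabilizer G act x} \<noteq> {}"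
      unfolding less.prems(3) by (metis card.empty)
    then obtain y where y: "y \<in> Y" "stabilizer G act x = stabilizer G act' y" by blast
    let ?O = "orbit G act x" and ?P = "orbit G act' y"
    obtain f where f: "bij_betw f ?O ?P"
      "\<forall>g\<in>carrier G. \<forall>z\<in>?O. f (act g z) = act' g (f z)"
      using equivariant_bij_orbits[OF less.prems(1,2) x y] by blast
    have O: "act g z \<in> ?O" if "g \<in> carrier G" "z \<in> ?O" for g z
      using A.act_in_orbit_iff[OF x _ that(1)] that(2) A.orbit_subset[OF x] by blast
    have rest: "card {z\<in>X - ?O. stabilizer G act z = H} = card {z\<in>Y - ?P. stabilizer G act' z = H}"
      for H
    proof -
      have "card {z\<in>?O. stabilizer G act z = H} = card {z\<in>?P. stabilizer G act' z = H}"
        by (rule equivariant_bij_card_stabilizer[OF f(1)]) (use f(2) O in auto)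
      moreover have "{z\<in>X - ?O. stabilizer G act z = H} =
          {z\<in>X. stabilizer G act z = H} - {z\<in>?O. stabilizer G act z = H}"
        "{z\<in>Y - ?P. stabilizer G act' z = H} =
          {z\<in>Y. stabilizer G act' z = H} - {z\<in>?P. stabilizer G act' z = H}" by auto
      moreover have "{z\<in>?O. stabilizer G act z = H} \<subseteq> {z\<in>X. stabilizer G act z = H}"
        "{z\<in>?P. stabilizer G act' z = H} \<subseteq> {z\<in>Y. stabilizer G act' z = H}"
        using A.orbit_subset[OF x] B.orbit_subset[OF y(1)] by auto
      ultimately show ?thesis
        using less.prems(3)[of H] finite_subset[OF A.orbit_subset[OF x] A.finite_points]
          finite_subset[OF B.orbit_subset[OF y(1)] B.finite_points]
        by (simp add: card_Diff_subset)
    qed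
    have "card (X - ?O) < card X"
      using A.finite_points A.self_in_orbit[OF x] x by (intro psubset_card_mono) auto
    from less.hyps[OF this A.remove_orbit[OF x] B.remove_orbit[OF y(1)] rest]
    obtain f' where f': "bij_betw f' (X - ?O) (Y - ?P)"
      "\<forall>g\<in>carrier G. \<forall>z\<in>X - ?O. f' (act g z) = act' g (f' z)" by blast
    let ?h = "\<lambda>z. if z \<in> ?O then f z else f' z"
    have "bij_betw ?h (?O \<union> (X - ?O)) (?P \<union> (Y - ?P))"
      by (rule bij_betw_disjoint_Un[OF f(1) f'(1)]) auto
    then have "bij_betw ?h X Y"
      using A.orbit_subset[OF x] B.orbit_subset[OF y(1)] by (simp add: Un_absorb1)
    moreover have "\<forall>g\<in>carrier G. \<forall>z\<in>X. ?h (act g z) = act' g (?h z)"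
      using f(2) f'(2) A.act_in_orbit_iff[OF x] by simp
    ultimately show ?thesis by blast
  qed
qed

section \<open>Subgroups of index at most two\<close>

text \<open>
  For a subgroup \<open>R\<close> the assumption on it expresses index at most two, by saying that all elements
  outside \<open>R\<close> lie in one coset. Each of \<open>A\<close> and \<open>B\<close> is then the union of its trace on \<open>R\<close> and the translate of this
  trace by \<open>t\<close>.
\<close>

lemma (in group) subgroups_eq_if_index2:
  assumes A: "subgroup A G" and B: "subgroup B G"
    and R: "\<And>a b. a \<in> carrier G - R \<Longrightarrow> b \<in> carrier G - R \<Longrightarrow> a \<otimes> inv b \<in> R"
    and eq: "A \<inter> R = B \<inter> R" and t: "t \<in> A" "t \<in> B" "t \<notin> R"
  shows "A = B"
proof -
  have "C \<subseteq> D" if C: "subgroup C G" and D: "subgroup D G" and CD: "C \<inter> R = D \<inter> R"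
    and t: "t \<in> C" "t \<in> D" for C D
  proof
    fix g assume g: "g \<in> C"
    show "g \<in> D"
    proof (cases "g \<in> R")
      case True
      with g CD show ?thesis by blast
    next
      case False
      have car: "g \<in> carrier G" "t \<in> carrier G"
        using g t C subgroup.mem_carrier by metis+
      then have "g \<otimes> inv t \<in> R" using R False \<open>t \<notin> R\<close> by blast
      moreover have "g \<otimes> inv t \<in> C"
        using C g t by (simp add: subgroup.m_closed subgroup.m_inv_closed)
      ultimately have "g \<otimes> inv t \<in> D" using CD by blast
      then have "g \<otimes> inv t \<otimes> t \<in> D" using t D by (simp add: subgroup.m_closed)
      then show ?thesis using car by (simp add: m_assoc)
    qed
  qed
  from this[OF A B eq t(1,2)] this[OF B A eq[symmetric] t(2,1)] show ?thesis by blast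
qed

text \<open>
  For \<open>H\<close> not contained in \<open>R\<close>, an element \<open>t \<in> H\<close> outside \<open>R\<close> turns the count into a number of
  fixed points of \<open>t\<close>. For \<open>H \<subseteq> R\<close>, the count is what remains of the points whose stabilizer has
  trace \<open>H\<close> on \<open>R\<close> after discarding those whose stabilizer is not contained in \<open>R\<close>, which the first
  case has already counted.
\<close>

lemma stabilizer_counts_if_index2:
  assumes "finite_action G act X" "finite_action G act' Y"
    and R: "\<And>a b. a \<in> carrier G - R \<Longrightarrow> b \<in> carrier G - R \<Longrightarrow> a \<otimes>\<^bsub>G\<^esub> inv\<^bsub>G\<^esub> b \<in> R"
    and fixed: "\<And>K g. g \<in> carrier G \<Longrightarrow>
      card {x\<in>X. stabilizer G act x \<inter> R = K \<and> act g x = x} =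
      card {y\<in>Y. stabilizer G act' y \<inter> R = K \<and> act' g y = y}"
  shows "card {x\<in>X. stabilizer G act x = H} = card {y\<in>Y. stabilizer G act' y = H}"
proof -
  interpret A: finite_action G act X by fact
  interpret B: finite_action G act' Y by fact
  let ?S = "stabilizer G act" and ?T = "stabilizer G act'"
  have outside: "card {x\<in>X. ?S x = H} = card {y\<in>Y. ?T y = H}" if H: "\<not> H \<subseteq> R" for H
  proof (cases "subgroup H G")
    case True
    from H obtain t where t: "t \<in> H" "t \<notin> R" by blast
    have tG: "t \<in> carrier G" using True t(1) by (rule subgroup.mem_carrier)
    have "?S x = H \<longleftrightarrow> ?S x \<inter> R = H \<inter> R \<and> act t x = x" if "x \<in> X" for x
      using A.subgroups_eq_if_index2[OF A.subgroup_stabilizer[OF that] True R _ _ t] t tG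
      by (auto simp: stabilizer_def)
    then have "{x\<in>X. ?S x = H} = {x\<in>X. ?S x \<inter> R = H \<inter> R \<and> act t x = x}" by blast
    moreover have "?T y = H \<longleftrightarrow> ?T y \<inter> R = H \<inter> R \<and> act' t y = y" if "y \<in> Y" for y
      using A.subgroups_eq_if_index2[OF B.subgroup_stabilizer[OF that] True R _ _ t] t tG
      by (auto simp: stabilizer_def)
    then have "{y\<in>Y. ?T y = H} = {y\<in>Y. ?T y \<inter> R = H \<inter> R \<and> act' t y = y}" by blast
    ultimately show ?thesis using fixed[OF tG] by simp
  next
    case False
    then have "{x\<in>X. ?S x = H} = {}" "{y\<in>Y. ?T y = H} = {}"
      using A.subgroup_stabilizer B.subgroup_stabilizer by blast+
    then show ?thesis by (simp only: card.empty)
  qed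
  show ?thesis
  proof (cases "H \<subseteq> R")
    case False
    then show ?thesis by (rule outside)
  next
    case True
    \<comment> \<open>Values from both sides are collected, so that one index set serves both sums.\<close>
    define I where "I = {H' \<in> ?S ` X \<union> ?T ` Y. H' \<inter> R = H \<and> H' \<noteq> H}"
    have I: "finite I" "\<And>H'. H' \<in> I \<Longrightarrow> H' \<inter> R = H" "\<And>H'. H' \<in> I \<Longrightarrow> \<not> H' \<subseteq> R" "H \<notin> I"
      using A.finite_points B.finite_points by (auto simp: I_def)
    have partition: "card {z\<in>Z. S z \<inter> R = H} = card {z\<in>Z. S z = H} + (\<Sum>H'\<in>I. card {z\<in>Z. S z = H'})"
      if Z: "finite Z" and S: "S ` Z \<subseteq> ?S ` X \<union> ?T ` Y" for Z :: "'z set" and S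
    proof -
      have "S z \<inter> R = H \<longleftrightarrow> S z \<in> insert H I" if "z \<in> Z" for z
      proof -
        have "S z \<in> ?S ` X \<union> ?T ` Y" using S that by blast
        then show ?thesis using True by (auto simp: I_def)
      qed
      then have "{z\<in>Z. S z \<inter> R = H} = (\<Union>H'\<in>insert H I. {z\<in>Z. S z = H'})" by blast
      then have "card {z\<in>Z. S z \<inter> R = H} = (\<Sum>H'\<in>insert H I. card {z\<in>Z. S z = H'})"
        using Z I(1) by (simp only:) (rule card_UN_disjoint, auto)
      then show ?thesis using I(1,4) by simp
    qed
    \<comment> \<open>The unit fixes every point, so \<open>fixed\<close> also compares all points with trace \<open>H\<close>.\<close>
    have "{x\<in>X. ?S x \<inter> R = H \<and> act \<one>\<^bsub>G\<^esub> x = x} = {x\<in>X. ?S x \<inter> R = H}"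
      "{y\<in>Y. ?T y \<inter> R = H \<and> act' \<one>\<^bsub>G\<^esub> y = y} = {y\<in>Y. ?T y \<inter> R = H}"
      by (auto simp: A.act_one B.act_one)
    then have "card {x\<in>X. ?S x \<inter> R = H} = card {y\<in>Y. ?T y \<inter> R = H}"
      using fixed[of "\<one>\<^bsub>G\<^esub>" H] by simp
    moreover have "(\<Sum>H'\<in>I. card {x\<in>X. ?S x = H'}) = (\<Sum>H'\<in>I. card {y\<in>Y. ?T y = H'})"
      using outside I(3) by (intro sum.cong) auto
    ultimately show ?thesis
      using partition[OF A.finite_points, of ?S] partition[OF B.finite_points, of ?T] by simp
  qed
qed

section \<open>Rotations in the dihedral group\<close>

abbreviation rotations :: "nat \<Rightarrow> dihedral_gen word set set" where
  "rotations m \<equiv> generate (dihedral_group m) {dih_r m}"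

lemma rotation_is_power:
  assumes "1 \<le> m" "g \<in> rotations m"
  shows "\<exists>j::nat. g = dih_r m [^]\<^bsub>dihedral_group m\<^esub> j"
proof -
  interpret group "dihedral_group m" by (rule dihedral_group_is_group)
  note r = dih_r_closed[of m]
  show ?thesis
    using assms(2)
  proof induction
    case one
    then show ?case by (intro exI[of _ 0]) simp
  next
    case (incl h)
    then show ?case using r by (intro exI[of _ 1]) simp
  next
    case (inv h)
    \<comment> \<open>For positive \<open>m\<close> the relation \<open>r\<^sup>m = 1\<close> makes the inverse of \<open>r\<close> a power with natural exponent.\<close>
    have "dih_r m [^]\<^bsub>dihedral_group m\<^esub> (m - 1) \<otimes>\<^bsub>dihedral_group m\<^esub> dih_r m = \<one>\<^bsub>dihedral_group m\<^esub>"
      using dih_r_pow[of m] assms(1) nat_pow_Suc[of "dih_r m" "m - 1"] by simp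
    then have "inv\<^bsub>dihedral_group m\<^esub> dih_r m = dih_r m [^]\<^bsub>dihedral_group m\<^esub> (m - 1)"
      using r by (intro inv_equality) auto
    with inv show ?case by auto
  next
    case (eng h1 h2)
    then show ?case using r nat_pow_mult[of "dih_r m"] by metis
  qed
qed

text \<open>
  Since \<open>s r s = r\<^sup>-\<^sup>1\<close>, conjugation by \<open>s\<close> preserves the subgroup \<open>R\<close> generated by \<open>r\<close>. Consequently
  \<open>R \<union> R s\<close> is closed under multiplication and is the whole group, and for \<open>a\<close> and \<open>b\<close> outside \<open>R\<close>
  the product \<open>(a s) (b s)\<^sup>-\<^sup>1 = a b\<^sup>-\<^sup>1\<close> lies in \<open>R\<close>.
\<close>

lemma (in group) index2_if_generated:
  assumes r: "r \<in> carrier G" and s: "s \<in> carrier G"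
    and ss: "s \<otimes> s = \<one>" and srs: "s \<otimes> r \<otimes> s = inv r"
    and gen: "generate G {r, s} = carrier G"
    and a: "a \<in> carrier G - generate G {r}" and b: "b \<in> carrier G - generate G {r}"
  shows "a \<otimes> inv b \<in> generate G {r}"
proof -
  let ?R = "generate G {r}"
  interpret R: subgroup ?R G using r by (intro generate_is_subgroup) simp
  have sinv: "inv s = s" using ss s by (metis inv_equality)
  have cancel: "s \<otimes> (s \<otimes> x) = x" if "x \<in> carrier G" for x
    using that s ss by (metis m_assoc l_one)
  have conj: "s \<otimes> x \<otimes> s \<in> ?R" if "x \<in> ?R" for x
    using that
  proof induction
    case one
    then show ?case using s ss generate.one by simp
  next
    case (incl h)
    then show ?case using srs generate.inv[of r "{r}" G] by simp
  next
    case (inv h)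
    have "s \<otimes> inv r \<otimes> s = r"
      unfolding srs[symmetric] using r s by (simp add: m_assoc cancel ss)
    then show ?case using inv generate.incl[of r "{r}" G] by simp
  next
    case (eng x y)
    then have "x \<in> carrier G" "y \<in> carrier G" using R.mem_carrier by auto
    then have "s \<otimes> (x \<otimes> y) \<otimes> s = s \<otimes> x \<otimes> s \<otimes> (s \<otimes> y \<otimes> s)"
      using s by (simp add: m_assoc cancel)
    with eng show ?case by simp
  qed
  have cosets: "g \<in> carrier G \<and> (g \<in> ?R \<or> g \<otimes> s \<in> ?R)" if "g \<in> generate G {r, s}" for g
    using that
  proof induction
    case one
    then show ?case by simp
  next
    case (incl h)
    then show ?case using r s ss generate.incl[of r "{r}" G] by auto
  next
    case (inv h)
    then show ?case using r s ss sinv generate.inv[of r "{r}" G] by auto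
  next
    case (eng g h)
    then have g: "g \<in> carrier G" and h: "h \<in> carrier G" by auto
    show ?case
    proof (cases "g \<in> ?R")
      case True
      then have "g \<otimes> h \<in> ?R \<or> g \<otimes> (h \<otimes> s) \<in> ?R" using eng by auto
      then show ?thesis using g h s by (simp add: m_assoc)
    next
      case False
      then have gs: "g \<otimes> s \<in> ?R" using eng by blast
      have "s \<otimes> h \<otimes> s \<in> ?R \<or> s \<otimes> (h \<otimes> s) \<otimes> s \<in> ?R" using conj eng by blast
      then have "g \<otimes> s \<otimes> (s \<otimes> h \<otimes> s) \<in> ?R \<or> g \<otimes> s \<otimes> (s \<otimes> (h \<otimes> s) \<otimes> s) \<in> ?R"
        using gs by auto
      then show ?thesis using g h s ss by (auto simp: m_assoc cancel)
    qed
  qed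
  have car: "a \<in> carrier G" "b \<in> carrier G" using a b by auto
  then have "a \<otimes> s \<in> ?R" "b \<otimes> s \<in> ?R" using cosets gen a b by auto
  then have "a \<otimes> s \<otimes> inv (b \<otimes> s) \<in> ?R" by simp
  moreover have "a \<otimes> s \<otimes> inv (b \<otimes> s) = a \<otimes> inv b"
    using car s by (simp add: inv_mult_group sinv m_assoc cancel)
  ultimately show ?thesis by simp
qed

section \<open>Blocks of points of equal period\<close>

text \<open>
  For a permutation \<open>\<sigma>\<close> the exponents \<open>j\<close> with \<open>(\<sigma> ^^ j) x = x\<close> are the multiples of the period of
  \<open>x\<close>. Indexing the blocks by this set of exponents, rather than by the period, treats fixed points
  and points of any other period alike and matches stabilizers in the subgroup of rotations.
\<close>

definition period_block :: "nat \<Rightarrow> (nat \<Rightarrow> nat) \<Rightarrow> nat set \<Rightarrow> nat set" where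
  "period_block n \<sigma> J = {x \<in> {1..n}. {j. (\<sigma> ^^ j) x = x} = J}"

lemma fix_set_eq_period_block: "fix_set n \<sigma> = period_block n \<sigma> UNIV"
proof -
  have "{j. (\<sigma> ^^ j) x = x} = UNIV \<longleftrightarrow> \<sigma> x = x" for x
  proof
    assume "{j. (\<sigma> ^^ j) x = x} = UNIV"
    then have "(\<sigma> ^^ 1) x = x" by blast
    then show "\<sigma> x = x" by simp
  next
    assume fixed: "\<sigma> x = x"
    have "(\<sigma> ^^ j) x = x" for j using fixed by (induction j) auto
    then show "{j. (\<sigma> ^^ j) x = x} = UNIV" by simp
  qed
  then show ?thesis by (simp add: fix_set_def period_block_def)
qed

lemma moved_set_eq_period_block:
  assumes "disjoint_cycle_decomposition \<sigma> cs" "2 \<le> k" "\<sigma> permutes {1..n}"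
  shows "moved_set n (cycles_of_length cs k) = period_block n \<sigma> {j. k dvd j}"
proof -
  have "moved_set n (cycles_of_length cs k) \<subseteq> {1..n}" by (auto simp: moved_set_def)
  then show ?thesis
    using moved_set_cycles_of_length(1)[OF assms] by (auto simp: period_block_def set_eq_iff)
qed

lemma comp_list_fixes:
  assumes "\<forall>p\<in>set ps. p x = x"
  shows "comp_list ps x = x"
  using assms by (induction ps) (auto simp: comp_list_simps)

lemma permutes_conj_eq_iff:
  assumes "h permutes X"
  shows "h \<circ> p \<circ> Hilbert_Choice.inv h = q \<longleftrightarrow> h \<circ> p = q \<circ> h"
  using permutes_inv_o[OF assms] by (metis comp_assoc comp_id)

lemma element_conjugate_sym_group_on_iff:
  "element_conjugate G (sym_group_on X) \<phi> \<psi> \<longleftrightarrow>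
    (\<forall>g\<in>carrier G. \<exists>h. h permutes X \<and> h \<circ> \<phi> g = \<psi> g \<circ> h)"
  by (auto simp: element_conjugate_def Bex_def sym_group_on_simps sym_group_on_inv
      permutes_conj_eq_iff cong: conj_cong)

lemma conjugate_homs_sym_group_iff:
  "conjugate_homs G (sym_group n) \<phi> \<psi> \<longleftrightarrow>
    (\<exists>h. h permutes {1..n} \<and> (\<forall>g\<in>carrier G. h \<circ> \<phi> g = \<psi> g \<circ> h))"
  unfolding conjugate_homs_def sym_group_on_atLeastAtMost[symmetric]
  by (simp add: Bex_def sym_group_on_simps sym_group_on_inv permutes_conj_eq_iff cong: conj_cong)

lemma hom_image_period_block:
  assumes "\<phi> \<in> hom (dihedral_group m) (sym_group n)" "\<phi> (dih_r m) = \<sigma>"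
    and "g \<in> carrier (dihedral_group m)"
  shows "\<phi> g x \<in> period_block n \<sigma> J \<longleftrightarrow> x \<in> period_block n \<sigma> J"
proof -
  have "\<phi> g permutes {1..n}"
    using hom_in_carrier[OF assms(1,3)] by (simp add: sym_group_carrier)
  from permutes_in_image[OF this] show ?thesis
    by (simp only: period_block_def mem_Collect_eq hom_image_period[OF assms])
qed

section \<open>Conjugacy of the homomorphisms and of their components\<close>

text \<open>
  The conjugating permutation commutes with the common image \<open>\<sigma>\<close> of the rotation, hence preserves
  periods and restricts to each block.
\<close>

lemma element_conjugate_component_if_conjugate:
  assumes "\<phi> \<in> hom (dihedral_group m) (sym_group n)" "\<phi> (dih_r m) = \<sigma>" "\<psi> (dih_r m) = \<sigma>"
    and "conjugate_homs (dihedral_group m) (sym_group n) \<phi> \<psi>"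
  shows "element_conjugate (dihedral_group m) (sym_group_on (period_block n \<sigma> J))
    (component \<phi> (period_block n \<sigma> J)) (component \<psi> (period_block n \<sigma> J))"
proof -
  let ?B = "period_block n \<sigma> J"
  obtain h where h: "h permutes {1..n}" "\<And>g. g \<in> carrier (dihedral_group m) \<Longrightarrow> h \<circ> \<phi> g = \<psi> g \<circ> h"
    using assms(4) unfolding conjugate_homs_sym_group_iff by blast
  have "h \<circ> \<sigma> = \<sigma> \<circ> h" using h(2)[OF dih_r_closed] assms(2,3) by simp
  then have "(\<sigma> ^^ j) (h x) = h x \<longleftrightarrow> (\<sigma> ^^ j) x = x" for j x
    using commute_funpow[of h \<sigma> \<sigma> j x] permutes_inj[OF h(1)] by (simp add: inj_eq)
  then have hB: "h x \<in> ?B \<longleftrightarrow> x \<in> ?B" for x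
    by (simp only: period_block_def mem_Collect_eq permutes_in_image[OF h(1)])
  have perm: "restrict_id h ?B permutes ?B"
    by (rule restrict_id_permutes[OF permutes_bij[OF h(1)] hB])
  have "restrict_id h ?B \<circ> component \<phi> ?B g = component \<psi> ?B g \<circ> restrict_id h ?B"
    if g: "g \<in> carrier (dihedral_group m)" for g
    using fun_cong[OF h(2)[OF g]] hom_image_period_block[OF assms(1,2) g] hB
    by (auto simp: fun_eq_iff component_def restrict_id_def)
  then show ?thesis
    using perm by (auto simp: element_conjugate_sym_group_on_iff)
qed

lemma finite_action_hom_sym_group:
  assumes "group G" "\<phi> \<in> hom G (sym_group n)"
  shows "finite_action G \<phi> {1..n}"
proof -
  interpret G: group G by fact
  interpret \<phi>: group_hom G "sym_group n" \<phi>
    using assms sym_group_is_group by (simp add: group_hom_def group_hom_axioms_def)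
  show ?thesis
  proof unfold_locales
    fix g x assume "g \<in> carrier G" "x \<in> {1..n}"
    then show "\<phi> g x \<in> {1..n}"
      using \<phi>.hom_closed[of g] permutes_in_image[of "\<phi> g" "{1..n}" x] by (simp add: sym_group_carrier)
  qed (use \<phi>.hom_mult \<phi>.hom_one in \<open>auto simp: sym_group_mult sym_group_one\<close>)
qed

text \<open>
  On rotations both homomorphisms are given by powers of \<open>\<sigma>\<close>, so a stabilizer in the subgroup of
  rotations corresponds to a set of exponents, whichever of the two actions it is taken for.
\<close>

lemma stabilizer_rotations_block:
  assumes "1 \<le> m" "\<phi> \<in> hom (dihedral_group m) (sym_group n)" "\<phi> (dih_r m) = \<sigma>"
    and "\<psi> \<in> hom (dihedral_group m) (sym_group n)" "\<psi> (dih_r m) = \<sigma>"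
    and "x\<^sub>0 \<in> {1..n}"
  shows "{x\<in>{1..n}. stabilizer (dihedral_group m) \<phi> x \<inter> rotations m =
      stabilizer (dihedral_group m) \<psi> x\<^sub>0 \<inter> rotations m} =
    period_block n \<sigma> {j. (\<sigma> ^^ j) x\<^sub>0 = x\<^sub>0}"
proof -
  let ?G = "dihedral_group m"
  interpret group ?G by (rule dihedral_group_is_group)
  have pow: "f (dih_r m [^]\<^bsub>?G\<^esub> j) = \<sigma> ^^ j"
    if f: "f \<in> hom ?G (sym_group n)" "f (dih_r m) = \<sigma>" for f and j :: nat
  proof (induction j)
    case 0
    then show ?case
      using hom_one[OF f(1) group_axioms sym_group_is_group] by (simp add: sym_group_one)
  next
    case (Suc j)
    then show ?case
      using hom_mult[OF f(1) nat_pow_closed[OF dih_r_closed, of j] dih_r_closed] f(2)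
      by (simp add: sym_group_mult funpow_Suc_right del: funpow.simps)
  qed
  have rot: "g \<in> rotations m \<longleftrightarrow> (\<exists>j::nat. g = dih_r m [^]\<^bsub>?G\<^esub> j)" for g
  proof
    interpret R: subgroup "rotations m" ?G
      using dih_r_closed by (intro generate_is_subgroup) simp
    have "dih_r m \<in> rotations m" by (rule generate.incl) simp
    then have "dih_r m [^]\<^bsub>?G\<^esub> j \<in> rotations m" for j :: nat by (induction j) auto
    then show "\<exists>j::nat. g = dih_r m [^]\<^bsub>?G\<^esub> j \<Longrightarrow> g \<in> rotations m" by blast
  qed (rule rotation_is_power[OF assms(1)])
  have stab: "stabilizer ?G f x \<inter> rotations m = (\<lambda>j. dih_r m [^]\<^bsub>?G\<^esub> j) ` {j. (\<sigma> ^^ j) x = x}"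
    if "f \<in> hom ?G (sym_group n)" "f (dih_r m) = \<sigma>" for f x
    using pow[OF that] dih_r_closed by (auto simp: stabilizer_def rot)
  have "{j. (\<sigma> ^^ j) x = x} = {j. (\<sigma> ^^ j) x\<^sub>0 = x\<^sub>0} \<longleftrightarrow>
      (\<lambda>j. dih_r m [^]\<^bsub>?G\<^esub> j) ` {j. (\<sigma> ^^ j) x = x} =
      (\<lambda>j. dih_r m [^]\<^bsub>?G\<^esub> j) ` {j. (\<sigma> ^^ j) x\<^sub>0 = x\<^sub>0}" for x
  proof
    assume eq: "(\<lambda>j. dih_r m [^]\<^bsub>?G\<^esub> j) ` {j. (\<sigma> ^^ j) x = x} =
      (\<lambda>j. dih_r m [^]\<^bsub>?G\<^esub> j) ` {j. (\<sigma> ^^ j) x\<^sub>0 = x\<^sub>0}"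
    have "dih_r m [^]\<^bsub>?G\<^esub> i \<in> (\<lambda>j. dih_r m [^]\<^bsub>?G\<^esub> j) ` {j. (\<sigma> ^^ j) z = z} \<longleftrightarrow> (\<sigma> ^^ i) z = z"
      for i :: nat and z
    proof
      assume "dih_r m [^]\<^bsub>?G\<^esub> i \<in> (\<lambda>j. dih_r m [^]\<^bsub>?G\<^esub> j) ` {j. (\<sigma> ^^ j) z = z}"
      then obtain j :: nat where "dih_r m [^]\<^bsub>?G\<^esub> i = dih_r m [^]\<^bsub>?G\<^esub> j" "(\<sigma> ^^ j) z = z" by auto
      then show "(\<sigma> ^^ i) z = z" using pow[OF assms(2,3), of i] pow[OF assms(2,3), of j] by simp
    qed simp
    from this[of _ x] this[of _ x\<^sub>0] show "{j. (\<sigma> ^^ j) x = x} = {j. (\<sigma> ^^ j) x\<^sub>0 = x\<^sub>0}"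
      unfolding eq by simp
  qed simp
  then show ?thesis
    unfolding stab[OF assms(2,3)] stab[OF assms(4,5)] period_block_def by simp
qed


lemma card_fixed_points_conjugate:
  assumes "finite X" "h permutes X" "h \<circ> p = q \<circ> h"
  shows "card {x\<in>X. p x = x} = card {x\<in>X. q x = x}"
proof (rule bij_betw_same_card)
  have fixed: "q (h x) = h x \<longleftrightarrow> p x = x" for x
    using fun_cong[OF assms(3), of x] permutes_inj[OF assms(2)] by (auto simp: inj_eq)
  have "h ` {x\<in>X. p x = x} = {x\<in>h ` X. q x = x}" using fixed by blast
  then show "bij_betw h {x\<in>X. p x = x} {x\<in>X. q x = x}"
    using permutes_imp_bij[OF assms(2)] by (auto simp: bij_betw_def inj_on_def)
qed

text \<open>
  The stabilizer counts of the two actions on \<open>{1..n}\<close> agree by \<open>stabilizer_counts_if_index2\<close>,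
  applied to the subgroup of rotations, and the resulting equivariant bijection is the conjugating
  permutation. Only blocks of the form assumed here occur, because a trace on the rotations that is
  not attained by any point contributes no points to either side.
\<close>

lemma conjugate_if_element_conjugate_components:
  assumes m: "1 \<le> m"
    and \<phi>: "\<phi> \<in> hom (dihedral_group m) (sym_group n)" "\<phi> (dih_r m) = \<sigma>"
    and \<psi>: "\<psi> \<in> hom (dihedral_group m) (sym_group n)" "\<psi> (dih_r m) = \<sigma>"
    and conj: "\<And>x J. x \<in> {1..n} \<Longrightarrow> J = {j. (\<sigma> ^^ j) x = x} \<Longrightarrow>
      element_conjugate (dihedral_group m) (sym_group_on (period_block n \<sigma> J))
        (component \<phi> (period_block n \<sigma> J)) (component \<psi> (period_block n \<sigma> J))"
  shows "conjugate_homs (dihedral_group m) (sym_group n) \<phi> \<psi>"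
proof -
  let ?G = "dihedral_group m" and ?R = "rotations m"
  interpret A: finite_action ?G \<phi> "{1..n}"
    by (rule finite_action_hom_sym_group[OF dihedral_group_is_group \<phi>(1)])
  interpret B: finite_action ?G \<psi> "{1..n}"
    by (rule finite_action_hom_sym_group[OF dihedral_group_is_group \<psi>(1)])
  have index2: "a \<otimes>\<^bsub>?G\<^esub> inv\<^bsub>?G\<^esub> b \<in> ?R" if "a \<in> carrier ?G - ?R" "b \<in> carrier ?G - ?R" for a b
    by (rule A.index2_if_generated[OF dih_r_closed dih_s_closed dih_s_square dih_srs dih_generate that])
  have fixed: "card {x\<in>{1..n}. stabilizer ?G \<phi> x \<inter> ?R = K \<and> \<phi> g x = x} =
      card {y\<in>{1..n}. stabilizer ?G \<psi> y \<inter> ?R = K \<and> \<psi> g y = y}"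
    if g: "g \<in> carrier ?G" for K g
  proof (cases "\<exists>x\<^sub>0\<in>{1..n}. K = stabilizer ?G \<phi> x\<^sub>0 \<inter> ?R \<or> K = stabilizer ?G \<psi> x\<^sub>0 \<inter> ?R")
    case False
    then have "{x\<in>{1..n}. stabilizer ?G \<phi> x \<inter> ?R = K \<and> \<phi> g x = x} = {}"
      "{y\<in>{1..n}. stabilizer ?G \<psi> y \<inter> ?R = K \<and> \<psi> g y = y} = {}" by blast+
    then show ?thesis by (simp only: card.empty)
  next
    case True
    then obtain x\<^sub>0 where x0: "x\<^sub>0 \<in> {1..n}"
      "K = stabilizer ?G \<phi> x\<^sub>0 \<inter> ?R \<or> K = stabilizer ?G \<psi> x\<^sub>0 \<inter> ?R" by blast
    let ?J = "{j. (\<sigma> ^^ j) x\<^sub>0 = x\<^sub>0}"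
    let ?B = "period_block n \<sigma> ?J"
    have B: "{x\<in>{1..n}. stabilizer ?G \<phi> x \<inter> ?R = K} = ?B"
      "{x\<in>{1..n}. stabilizer ?G \<psi> x \<inter> ?R = K} = ?B"
      using x0(2) stabilizer_rotations_block[OF m \<phi> \<phi> x0(1)] stabilizer_rotations_block[OF m \<phi> \<psi> x0(1)]
        stabilizer_rotations_block[OF m \<psi> \<phi> x0(1)] stabilizer_rotations_block[OF m \<psi> \<psi> x0(1)]
      by auto
    obtain h where "h permutes ?B" "h \<circ> component \<phi> ?B g = component \<psi> ?B g \<circ> h"
      using conj[OF x0(1) HOL.refl] g unfolding element_conjugate_sym_group_on_iff by blast
    then have "card {x\<in>?B. component \<phi> ?B g x = x} = card {x\<in>?B. component \<psi> ?B g x = x}"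
      by (intro card_fixed_points_conjugate) (simp_all add: period_block_def)
    moreover have "{x\<in>{1..n}. stabilizer ?G \<phi> x \<inter> ?R = K \<and> \<phi> g x = x} = {x\<in>?B. component \<phi> ?B g x = x}"
      unfolding B(1)[symmetric] by (auto simp: component_def restrict_id_def)
    moreover have "{x\<in>{1..n}. stabilizer ?G \<psi> x \<inter> ?R = K \<and> \<psi> g x = x} = {x\<in>?B. component \<psi> ?B g x = x}"
      unfolding B(2)[symmetric] by (auto simp: component_def restrict_id_def)
    ultimately show ?thesis by simp
  qed
  have "\<exists>f. bij_betw f {1..n} {1..n} \<and>
      (\<forall>g\<in>carrier ?G. \<forall>x\<in>{1..n}. f (\<phi> g x) = \<psi> g (f x))"
    by (rule equivariant_bij_if_stabilizer_counts[OF A.finite_action_axioms B.finite_action_axioms],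
        rule stabilizer_counts_if_index2[OF A.finite_action_axioms B.finite_action_axioms index2 fixed])
  then obtain f where f: "bij_betw f {1..n} {1..n}"
    "\<forall>g\<in>carrier ?G. \<forall>x\<in>{1..n}. f (\<phi> g x) = \<psi> g (f x)" by blast
  \<comment> \<open>Outside \<open>{1..n}\<close> the bijection is unspecified; a permutation of \<open>{1..n}\<close> must fix those points.\<close>
  let ?h = "restrict_id f {1..n}"
  have "bij_betw ?h {1..n} {1..n}"
    using f(1) by (rule iffD1[OF bij_betw_cong, rotated]) (simp add: restrict_id_def)
  then have "?h permutes {1..n}" by (rule bij_imp_permutes) (auto simp: restrict_id_def)
  moreover have "?h \<circ> \<phi> g = \<psi> g \<circ> ?h" if g: "g \<in> carrier ?G" for g
  proof
    fix x
    have p: "\<phi> g permutes {1..n}" "\<psi> g permutes {1..n}"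
      using hom_in_carrier[OF \<phi>(1) g] hom_in_carrier[OF \<psi>(1) g] by (simp_all add: sym_group_carrier)
    show "(?h \<circ> \<phi> g) x = (\<psi> g \<circ> ?h) x"
    proof (cases "x \<in> {1..n}")
      case True
      then have "\<phi> g x \<in> {1..n}" by (rule A.act_closed[OF g])
      then show ?thesis using True f(2) g by (simp add: restrict_id_def)
    next
      case False
      then show ?thesis using permutes_not_in[OF p(1) False] permutes_not_in[OF p(2) False]
        by (auto simp: restrict_id_def)
    qed
  qed
  ultimately show ?thesis unfolding conjugate_homs_sym_group_iff by blast
qed

theorem corollary3p9:
  fixes m n l :: nat
    and \<phi> \<psi> :: "dihedral_gen word set \<Rightarrow> nat \<Rightarrow> nat"
    and \<sigma> :: "nat \<Rightarrow> nat"
    and cs :: "nat list list"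
    and d :: "nat \<Rightarrow> nat"
    and \<sigma>s :: "nat \<Rightarrow> nat \<Rightarrow> nat"
  assumes "1 \<le> m"
    and "\<phi> \<in> hom (dihedral_group m) (sym_group n)"
    and "\<psi> \<in> hom (dihedral_group m) (sym_group n)"
    and "generator_conjugate {dih_r m, dih_s m} (sym_group n) \<phi> \<psi>"
    and "\<phi> (dih_r m) = \<sigma>"
    and "\<psi> (dih_r m) = \<sigma>"
    and "disjoint_cycle_decomposition \<sigma> cs"
    and "inj_on d {1..l}"
    and "\<forall>i\<in>{1..l}. 2 \<le> d i"
    and "\<forall>i\<in>{1..l}. \<sigma>s i = cycles_of_length cs (d i)"
    and "\<sigma> = comp_list (map \<sigma>s [1..<Suc l])"
  shows "conjugate_homs (dihedral_group m) (sym_group n) \<phi> \<psi> \<longleftrightarrow>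
      element_conjugate (dihedral_group m) (sym_group_on (fix_set n \<sigma>))
        (component \<phi> (fix_set n \<sigma>)) (component \<psi> (fix_set n \<sigma>)) \<and>
      (\<forall>i\<in>{1..l}.
         element_conjugate (dihedral_group m) (sym_group_on (moved_set n (\<sigma>s i)))
           (component \<phi> (moved_set n (\<sigma>s i))) (component \<psi> (moved_set n (\<sigma>s i))))"
    (is "?conj \<longleftrightarrow> ?fix \<and> ?moved")
proof
  have \<sigma>: "\<sigma> permutes {1..n}"
    using hom_in_carrier[OF assms(2) dih_r_closed] assms(5) by (simp add: sym_group_carrier)
  have moved: "moved_set n (\<sigma>s i) = period_block n \<sigma> {j. d i dvd j}" if "i \<in> {1..l}" for i
    using moved_set_eq_period_block[OF assms(7) _ \<sigma>] assms(9,10) that by simp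
  show "?fix \<and> ?moved" if ?conj
    using element_conjugate_component_if_conjugate[OF assms(2,5,6) that] moved
    by (simp add: fix_set_eq_period_block)
  assume conj: "?fix \<and> ?moved"
  show ?conj
  proof (rule conjugate_if_element_conjugate_components[OF assms(1,2,5,3,6)])
    fix x J assume x: "x \<in> {1..n}" and J: "J = {j. (\<sigma> ^^ j) x = x}"
    then have xJ: "x \<in> period_block n \<sigma> J' \<Longrightarrow> J = J'" for J' by (simp add: period_block_def)
    show "element_conjugate (dihedral_group m) (sym_group_on (period_block n \<sigma> J))
        (component \<phi> (period_block n \<sigma> J)) (component \<psi> (period_block n \<sigma> J))"
    proof (cases "\<sigma> x = x")
      case True
      then have "x \<in> fix_set n \<sigma>" using x by (simp add: fix_set_def)
      then have "J = UNIV" using xJ by (simp add: fix_set_eq_period_block)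
      then show ?thesis using conj by (simp add: fix_set_eq_period_block)
    next
      case False
      then have "comp_list (map \<sigma>s [1..<Suc l]) x \<noteq> x" using assms(11) by simp
      then have "\<exists>i\<in>{1..l}. \<sigma>s i x \<noteq> x"
        using comp_list_fixes[of "map \<sigma>s [1..<Suc l]" x]
        by (auto simp del: upt_Suc simp: atLeastLessThanSuc_atLeastAtMost)
      then obtain i where i: "i \<in> {1..l}" "\<sigma>s i x \<noteq> x" by blast
      then have "x \<in> moved_set n (\<sigma>s i)" using x by (simp add: moved_set_def fix_set_def)
      then have "J = {j. d i dvd j}" using xJ moved[OF i(1)] by simp
      then show ?thesis using conj i(1) moved[OF i(1)] by fastforce
    qed
  qed
qed

end
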